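(* For every integer $m\geq 3$ with $m\neq 6$, let $k=k(m)$ be the unique integer such that $2^k+2^{k-1}\leq m<2^k+2^{k+1}$. Then $$H_{2}(m,2)=H_{2}(2^k,2)\,2^{m-2^k}+H_{2}(m-2^k,2)\,2^{2^k}+2^k(m-2^k).$$ For $m=6$, $H_2(6,2)=2\cdot H_2(3,2)\cdot 2^{3}+9$. Consequently, $$\lim_{m\to\infty}\frac{H_{2}(m,2)}{m2^{m-1}}=\sum_{j=1}^{\infty}\frac{2^{j-1}}{2^{2^j}}.$$
   Context: A triangular choice multigraph (TCM) $\mathcal{G}$ on a vertex set $V$ is obtained by choosing, for every 3-element subset $\{u,v,w\}\subseteq V$, exactly one of the pairs $uv,uw,vw$ and adding one copy of it as an edge; $m^{\mathcal{G}}_{xy}$ is the multiplicity of the pair $xy$, and for a TCM on $[m]$, $w(\mathcal{G},2)=\sum_{xy\in\binom{[m]}{2}}2^{m^{\mathcal{G}}_{xy}}$. A TCM $\mathcal{G}$ on $V$ is 2-recursive if either $|V|\in\{1,2\}$ and $\mathcal{G}$ is empty, or $|V|\geq 3$ and there is a partition $V=V_1\cup V_2$ with $V_1,V_2\neq\emptyset$ such that $\mathcal{G}=\mathcal{G}_1\cup\mathcal{G}_2\cup\mathcal{G}_3$ (union with multiplicities), where $\mathcal{G}_i$ is a 2-recursive TCM on $V_i$ and $\mathcal{G}_3$ consists of: for every triple with $u,v\in V_1$, $w\in V_2$ a copy of $uv$, and for every triple with $u\in V_1$, $v,w\in V_2$ a copy of $vw$. $H_2(m,2)$ is the maximum of $w(\mathcal{G},2)$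 over all 2-recursive TCMs on $[m]$. *)

theory Defs
  imports Complex_Main "HOL-Library.Multiset" "HOL-Library.FuncSet"
begin

text \<open>A multigraph on \<open>V\<close> is represented by the multiset of its edges; an edge is a two-element
  subset of \<open>V\<close>, and the multiplicity of the pair \<open>xy\<close> is \<open>count G {x, y}\<close>.\<close>

definition pairs :: "'a set \<Rightarrow> 'a set set" where
  "pairs V = {e. e \<subseteq> V \<and> card e = 2}"

definition triples :: "'a set \<Rightarrow> 'a set set" where
  "triples V = {T. T \<subseteq> V \<and> card T = 3}"

text \<open>Triangular choice multigraphs; \<open>c\<close> is the choice of a pair from every triple. All vertex
  sets are finite.\<close>

definition tcm :: "'a set \<Rightarrow> 'a set multiset \<Rightarrow> bool" where
  "tcm V G \<longleftrightarrow> finite V \<and>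
     (\<exists>c. (\<forall>T\<in>triples V. c T \<in> pairs T) \<and> G = image_mset c (mset_set (triples V)))"

text \<open>The multigraph \<open>G\<^sub>3\<close>: every triple with two vertices in one of the parts and one vertex
  in the other contributes a copy of the pair inside the former part.\<close>

definition crossing :: "'a set \<Rightarrow> 'a set \<Rightarrow> 'a set multiset" where
  "crossing V1 V2 =
     image_mset (\<lambda>T. T \<inter> V1) (mset_set {T \<in> triples (V1 \<union> V2). card (T \<inter> V1) = 2 \<and> card (T \<inter> V2) = 1})
   + image_mset (\<lambda>T. T \<inter> V2) (mset_set {T \<in> triples (V1 \<union> V2). card (T \<inter> V1) = 1 \<and> card (T \<inter> V2) = 2})"

inductive two_recursive :: "'a set \<Rightarrow> 'a set multiset \<Rightarrow> bool" where
  small: "two_recursive V {#}" if "tcm V {#}" and "card V \<in> {1, 2}"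
| split: "two_recursive V G"
    if "tcm V G" and "card V \<ge> 3"
      and "V = V1 \<union> V2" and "V1 \<inter> V2 = {}" and "V1 \<noteq> {}" and "V2 \<noteq> {}"
      and "two_recursive V1 G1" and "two_recursive V2 G2"
      and "G = G1 + G2 + crossing V1 V2"

text \<open>\<open>w(G, 2)\<close> for a multigraph \<open>G\<close> on \<open>{1..m}\<close>, and \<open>H\<^sub>2(m, 2)\<close>.\<close>

definition weight2 :: "nat \<Rightarrow> nat set multiset \<Rightarrow> nat" where
  "weight2 m G = (\<Sum>e\<in>pairs {1..m}. 2 ^ count G e)"

definition H2 :: "nat \<Rightarrow> nat" where
  "H2 m = Max {weight2 m G | G. two_recursive {1..m} G}"

text \<open>The maximum in the definition of \<open>H2\<close> is over a finite set, which is nonempty for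
  \<open>m \<ge> 1\<close>. Moreover, the condition of being a TCM in the recursive rule holds automatically.\<close>

lemma two_recursive_imp_tcm: "two_recursive V G \<Longrightarrow> tcm V G"
  by (induction rule: two_recursive.induct) auto

lemma finite_triples: "finite V \<Longrightarrow> finite (triples V)"
  by (rule finite_subset[of _ "Pow V"]) (auto simp: triples_def)

lemma finite_pairs: "finite V \<Longrightarrow> finite (pairs V)"
  by (rule finite_subset[of _ "Pow V"]) (auto simp: pairs_def)

lemma finite_tcm:
  assumes "finite V"
  shows "finite {G. tcm V G}"
proof (rule finite_subset)
  let ?F = "PiE (triples V) (\<lambda>T. pairs T)"
  let ?g = "\<lambda>c. image_mset c (mset_set (triples V))"
  show "{G. tcm V G} \<subseteq> ?g ` ?F"
  proof
    fix G assume "G \<in> {G. tcm V G}"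
    then obtain c where c: "\<forall>T\<in>triples V. c T \<in> pairs T" "G = ?g c"
      by (auto simp: tcm_def)
    have "?g c = ?g (restrict c (triples V))"
      using finite_triples[OF assms] by (intro image_mset_cong) auto
    moreover have "restrict c (triples V) \<in> ?F" using c(1) by auto
    ultimately show "G \<in> ?g ` ?F" using c(2) by blast
  qed
  have "finite (pairs T)" if "T \<in> triples V" for T
    using that assms by (intro finite_pairs) (auto simp: triples_def intro: finite_subset)
  then show "finite (?g ` ?F)"
    using finite_triples[OF assms] by (intro finite_imageI finite_PiE) auto
qed

lemma tcm_union:
  assumes "tcm V1 G1" "tcm V2 G2" and disj: "V1 \<inter> V2 = {}"
  shows "tcm (V1 \<union> V2) (G1 + G2 + crossing V1 V2)"
proof -
  obtain c1 where c1: "\<forall>T\<in>triples V1. c1 T \<in> pairs T" "G1 = image_mset c1 (mset_set (triples V1))"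
    using assms(1) by (auto simp: tcm_def)
  obtain c2 where c2: "\<forall>T\<in>triples V2. c2 T \<in> pairs T" "G2 = image_mset c2 (mset_set (triples V2))"
    using assms(2) by (auto simp: tcm_def)
  have fin: "finite V1" "finite V2" using assms by (auto simp: tcm_def)
  define A where "A = {T \<in> triples (V1 \<union> V2). card (T \<inter> V1) = 2 \<and> card (T \<inter> V2) = 1}"
  define B where "B = {T \<in> triples (V1 \<union> V2). card (T \<inter> V1) = 1 \<and> card (T \<inter> V2) = 2}"
  define c where "c T = (if T \<in> A then T \<inter> V1 else if T \<in> B then T \<inter> V2
      else if T \<in> triples V1 then c1 T else c2 T)" for T
  have t1: "card (T \<inter> V1) = 3 \<and> card (T \<inter> V2) = 0" if "T \<in> triples V1" for T
  proof -
    have "T \<inter> V1 = T" "T \<inter> V2 = {}" using that disj by (auto simp: triples_def)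
    then show ?thesis using that by (auto simp: triples_def)
  qed
  have t2: "card (T \<inter> V1) = 0 \<and> card (T \<inter> V2) = 3" if "T \<in> triples V2" for T
  proof -
    have "T \<inter> V2 = T" "T \<inter> V1 = {}" using that disj by (auto simp: triples_def)
    then show ?thesis using that by (auto simp: triples_def)
  qed
  have dec: "triples (V1 \<union> V2) = triples V1 \<union> triples V2 \<union> (A \<union> B)"
  proof (intro equalityI subsetI)
    fix T assume T: "T \<in> triples (V1 \<union> V2)"
    then have TV: "T = (T \<inter> V1) \<union> (T \<inter> V2)" and cT: "card T = 3" by (auto simp: triples_def)
    have "card T = card (T \<inter> V1) + card (T \<inter> V2)"
      using fin disj by (subst TV, subst card_Un_disjoint) auto
    then consider "card (T \<inter> V1) = 0" | "card (T \<inter> V2) = 0"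
      | "card (T \<inter> V1) = 1" "card (T \<inter> V2) = 2" | "card (T \<inter> V1) = 2" "card (T \<inter> V2) = 1"
      using cT by linarith
    then show "T \<in> triples V1 \<union> triples V2 \<union> (A \<union> B)"
    proof cases
      case 1
      then have "T \<inter> V1 = {}" using fin by simp
      then have "T \<in> triples V2" using T by (auto simp: triples_def)
      then show ?thesis by simp
    next
      case 2
      then have "T \<inter> V2 = {}" using fin by simp
      then have "T \<in> triples V1" using T by (auto simp: triples_def)
      then show ?thesis by simp
    next
      case 3
      then show ?thesis using T by (auto simp: B_def)
    next
      case 4
      then show ?thesis using T by (auto simp: A_def)
    qed
  next
    fix T assume "T \<in> triples V1 \<union> triples V2 \<union> (A \<union> B)"
    then show "T \<in> triples (V1 \<union> V2)" by (auto simp: A_def B_def triples_def)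
  qed
  have d: "triples V1 \<inter> triples V2 = {}" "(triples V1 \<union> triples V2) \<inter> (A \<union> B) = {}" "A \<inter> B = {}"
  proof -
    show "triples V1 \<inter> triples V2 = {}"
      using t1 t2 by (metis disjoint_iff zero_neq_numeral)
    have "T \<notin> A \<union> B" if "T \<in> triples V1 \<union> triples V2" for T
      using that t1[of T] t2[of T] by (auto simp: A_def B_def)
    then show "(triples V1 \<union> triples V2) \<inter> (A \<union> B) = {}" by blast
    show "A \<inter> B = {}" by (auto simp: A_def B_def)
  qed
  have f: "finite (triples V1)" "finite (triples V2)" "finite A" "finite B"
    using fin finite_triples[of "V1 \<union> V2"] by (auto simp: finite_triples A_def B_def)
  have "image_mset c (mset_set (triples (V1 \<union> V2))) =
      image_mset c (mset_set (triples V1)) + image_mset c (mset_set (triples V2))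
      + (image_mset c (mset_set A) + image_mset c (mset_set B))"
    using d f by (simp add: dec mset_set_Union)
  also have "image_mset c (mset_set (triples V1)) = G1"
    unfolding c1(2) using f d by (intro image_mset_cong) (auto simp: c_def)
  also have "image_mset c (mset_set (triples V2)) = G2"
    unfolding c2(2) using f d by (intro image_mset_cong) (auto simp: c_def)
  also have "image_mset c (mset_set A) = image_mset (\<lambda>T. T \<inter> V1) (mset_set A)"
    using f by (intro image_mset_cong) (auto simp: c_def)
  also have "image_mset c (mset_set B) = image_mset (\<lambda>T. T \<inter> V2) (mset_set B)"
    using f d by (intro image_mset_cong) (auto simp: c_def)
  finally have G: "G1 + G2 + crossing V1 V2 = image_mset c (mset_set (triples (V1 \<union> V2)))"
    by (simp add: crossing_def A_def B_def)
  have "c T \<in> pairs T" if "T \<in> triples (V1 \<union> V2)" for T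
  proof -
    consider "T \<in> A" | "T \<in> B" "T \<notin> A" | "T \<in> triples V1" "T \<notin> A" "T \<notin> B"
      | "T \<in> triples V2" "T \<notin> triples V1" "T \<notin> A" "T \<notin> B"
      using \<open>T \<in> triples (V1 \<union> V2)\<close> unfolding dec by blast
    then show ?thesis
    proof cases
      case 1
      then show ?thesis by (simp add: c_def) (simp add: A_def pairs_def)
    next
      case 2
      then show ?thesis by (simp add: c_def) (simp add: B_def pairs_def)
    next
      case 3
      then show ?thesis using c1(1) by (simp add: c_def)
    next
      case 4
      then show ?thesis using c2(1) by (simp add: c_def)
    qed
  qed
  then show ?thesis unfolding tcm_def using G fin by (intro conjI exI[of _ c] ballI) simp_all
qed

lemma two_recursive_exists:
  assumes "finite V" "V \<noteq> {}"
  shows "\<exists>G. two_recursive V G"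
  using assms
proof (induction "card V" arbitrary: V rule: less_induct)
  case less
  show ?case
  proof (cases "card V \<ge> 3")
    case False
    have "card V > 0" using less.prems by (simp add: card_gt_0_iff)
    then have cV: "card V \<in> {1, 2}" using False by (simp, linarith)
    have "triples V = {}"
    proof -
      have "card T \<noteq> 3" if "T \<subseteq> V" for T
        using card_mono[OF less.prems(1) that] False by linarith
      then show ?thesis by (auto simp: triples_def)
    qed
    then have "tcm V {#}" using less.prems by (simp add: tcm_def)
    then show ?thesis using cV two_recursive.small by blast
  next
    case True
    obtain v where v: "v \<in> V" using less.prems by auto
    have c: "card (V - {v}) = card V - 1" using v less.prems by simp
    then have ne: "V - {v} \<noteq> {}" using True by (intro notI) simp
    have lt1: "card {v} < card V" and lt2: "card (V - {v}) < card V"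
      using c True by simp_all
    obtain G1 where G1: "two_recursive {v} G1"
      using less.hyps[OF lt1] by blast
    obtain G2 where G2: "two_recursive (V - {v}) G2"
      using less.hyps[OF lt2 _ ne] less.prems by blast
    have eq: "V = {v} \<union> (V - {v})" using v by auto
    have disj: "{v} \<inter> (V - {v}) = {}" by simp
    have "tcm V (G1 + G2 + crossing {v} (V - {v}))"
      using tcm_union[OF two_recursive_imp_tcm[OF G1] two_recursive_imp_tcm[OF G2] disj]
      unfolding eq[symmetric] .
    then show ?thesis
      using two_recursive.split[OF _ True eq disj _ ne G1 G2 refl] by blast
  qed
qed

lemma H2_max_wf:
  "finite {weight2 m G | G. two_recursive {1..m} G}"
  "m \<ge> 1 \<Longrightarrow> {weight2 m G | G. two_recursive {1..m} G} \<noteq> {}"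
proof -
  have "{G. two_recursive {1..m} G} \<subseteq> {G. tcm {1..m} G}"
    using two_recursive_imp_tcm by auto
  then have "finite {G. two_recursive {1..m} G}"
    by (rule finite_subset) (simp add: finite_tcm)
  then have "finite (weight2 m ` {G. two_recursive {1..m} G})" by (rule finite_imageI)
  then show "finite {weight2 m G | G. two_recursive {1..m} G}" by (simp only: setcompr_eq_image)
next
  assume "m \<ge> 1"
  then show "{weight2 m G | G. two_recursive {1..m} G} \<noteq> {}"
    using two_recursive_exists[of "{1..m}"] by fastforce
qed

end

(* Dividing weights on n vertices by 2^n and writing nopt n for the normalised maximum and
   dens n = n / 2^n, a split into parts of sizes a and b has value nopt a + nopt b + dens a * dens b.
   So the theorem says that the function obtained by always splitting off the power of two 2^k is
   superadditive with this surplus term. The main tool is rotation: ((p, q), r) may be replaced by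
   (p, (q, r)) whenever r <= p, because n / (2^n - 1) is decreasing. Hence only splits (a, b) remain in
   which each part is at least as large as both pieces of the other; these a and b are of comparable
   size, and regrouping their pieces around powers of two gains more than it loses, since dens decays
   exponentially. The limit is Fekete's lemma, evaluated along n = 2^k. *)

theory Submission imports Defs begin

section \<open>The recursion for the weights\<close>

text \<open>The parts of a split are arbitrary finite sets, so \<open>weight2\<close> is restated
  for any vertex set.\<close>

definition weight :: "'a set \<Rightarrow> 'a set multiset \<Rightarrow> nat" where
  "weight V G = (\<Sum>e\<in>pairs V. 2 ^ count G e)"

lemma tcm_count_eq_0:
  assumes "tcm V G" "e \<notin> pairs V"
  shows "count G e = 0"
proof -
  obtain c where c: "\<forall>T\<in>triples V. c T \<in> pairs T" "G = image_mset c (mset_set (triples V))"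
    and fin: "finite V"
    using assms(1) by (auto simp: tcm_def)
  have "set_mset G \<subseteq> pairs V"
    using c finite_triples[OF fin] by (auto simp: triples_def pairs_def)
  then show ?thesis using assms(2) by (meson count_eq_zero_iff subsetD)
qed

lemma crossing_commute: "crossing V1 V2 = crossing V2 V1"
  by (simp add: crossing_def Un_commute conj_commute add.commute)

text \<open>Exactly the triples \<open>insert w e\<close> with \<open>w\<close> in \<open>V2\<close>
  choose \<open>e\<close>, one for each \<open>w\<close>; the other summand of
  \<open>crossing\<close> only has pairs inside \<open>V2\<close>.\<close>

lemma count_crossing_inside:
  assumes "finite V1" "finite V2" and disj: "V1 \<inter> V2 = {}" and e: "e \<in> pairs V1"
  shows "count (crossing V1 V2) e = card V2"
proof -
  define A where "A = {T \<in> triples (V1 \<union> V2). card (T \<inter> V1) = 2 \<and> card (T \<inter> V2) = 1}"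
  define B where "B = {T \<in> triples (V1 \<union> V2). card (T \<inter> V1) = 1 \<and> card (T \<inter> V2) = 2}"
  have fin: "finite A" "finite B"
    using assms finite_triples[of "V1 \<union> V2"] by (auto simp: A_def B_def)
  have e': "e \<subseteq> V1" "card e = 2" "finite e"
    using e assms(1) by (auto simp: pairs_def intro: finite_subset)
  have "{T \<in> A. T \<inter> V1 = e} = (\<lambda>w. insert w e) ` V2"
  proof (intro equalityI subsetI)
    fix T assume T: "T \<in> {T \<in> A. T \<inter> V1 = e}"
    then obtain w where w: "T \<inter> V2 = {w}" by (auto simp: A_def card_1_singleton_iff)
    have "T = (T \<inter> V1) \<union> (T \<inter> V2)" using T by (auto simp: A_def triples_def)
    with T w have "T = insert w e" by auto
    with w show "T \<in> (\<lambda>w. insert w e) ` V2" by auto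
  next
    fix T assume "T \<in> (\<lambda>w. insert w e) ` V2"
    then obtain w where w: "w \<in> V2" "T = insert w e" by auto
    have "T \<inter> V1 = e" "T \<inter> V2 = {w}" "w \<notin> e" using w e' disj by auto
    then show "T \<in> {T \<in> A. T \<inter> V1 = e}" using w e' by (auto simp: A_def triples_def)
  qed
  moreover have "inj_on (\<lambda>w. insert w e) V2"
    using e' disj by (intro inj_onI) blast
  ultimately have "card {T \<in> A. T \<inter> V1 = e} = card V2" by (simp add: card_image)
  moreover have "{T \<in> B. T \<inter> V2 = e} = {}"
  proof -
    have "e \<noteq> {}" "e \<inter> V2 = {}" using e' disj by auto
    then show ?thesis by auto
  qed
  moreover have "count (image_mset f (mset_set X)) e = card {T \<in> X. f T = e}"
    if "finite X" for f :: "'a set \<Rightarrow> 'a set" and X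
  proof -
    have "f -` {e} \<inter> X = {T \<in> X. f T = e}" by auto
    then show ?thesis using that by (simp add: count_image_mset)
  qed
  ultimately show ?thesis
    using fin unfolding crossing_def A_def[symmetric] B_def[symmetric] by simp
qed

lemma count_crossing_across:
  assumes "finite V1" "finite V2" "\<not> e \<subseteq> V1" "\<not> e \<subseteq> V2"
  shows "count (crossing V1 V2) e = 0"
  using assms finite_triples[of "V1 \<union> V2"] by (auto simp: crossing_def count_eq_zero_iff)

lemma card_pairs_across:
  assumes "finite V1" "finite V2" and disj: "V1 \<inter> V2 = {}"
  shows "card ((\<lambda>(x, y). {x, y}) ` (V1 \<times> V2)) = card V1 * card V2"
proof -
  have "inj_on (\<lambda>(x, y). {x, y}) (V1 \<times> V2)"
    using disj by (auto simp: inj_on_def doubleton_eq_iff)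
  then show ?thesis by (simp add: card_image card_cartesian_product)
qed

lemma pairs_Un:
  assumes "V1 \<inter> V2 = {}"
  shows "pairs (V1 \<union> V2) = pairs V1 \<union> pairs V2 \<union> (\<lambda>(x, y). {x, y}) ` (V1 \<times> V2)"
proof (intro equalityI subsetI)
  fix e assume "e \<in> pairs (V1 \<union> V2)"
  then obtain x y where e: "e = {x, y}" "x \<noteq> y" "x \<in> V1 \<union> V2" "y \<in> V1 \<union> V2"
    by (auto simp: pairs_def card_2_iff)
  then consider "e \<in> pairs V1" | "e \<in> pairs V2" | "x \<in> V1" "y \<in> V2" | "y \<in> V1" "x \<in> V2"
    by (auto simp: pairs_def)
  then show "e \<in> pairs V1 \<union> pairs V2 \<union> (\<lambda>(x, y). {x, y}) ` (V1 \<times> V2)"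
    by cases (use e in \<open>auto simp: insert_commute\<close>)
next
  fix e assume "e \<in> pairs V1 \<union> pairs V2 \<union> (\<lambda>(x, y). {x, y}) ` (V1 \<times> V2)"
  moreover have "card {x, y} = 2" if "x \<in> V1" "y \<in> V2" for x y
    using that assms by (cases "x = y") auto
  ultimately show "e \<in> pairs (V1 \<union> V2)" by (auto simp: pairs_def)
qed

text \<open>A pair inside one part gains the size of the other part in multiplicity, which scales
  its power of two; a pair across the parts has multiplicity 0 and contributes 1.\<close>

lemma weight_split:
  assumes G1: "tcm V1 G1" and G2: "tcm V2 G2" and disj: "V1 \<inter> V2 = {}"
  shows "weight (V1 \<union> V2) (G1 + G2 + crossing V1 V2) =
    weight V1 G1 * 2 ^ card V2 + weight V2 G2 * 2 ^ card V1 + card V1 * card V2"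
proof -
  let ?G = "G1 + G2 + crossing V1 V2" and ?X = "(\<lambda>(x, y). {x, y}) ` (V1 \<times> V2)"
  have fin: "finite V1" "finite V2" using G1 G2 by (auto simp: tcm_def)
  have d: "pairs V1 \<inter> pairs V2 = {}"
  proof (rule equals0I)
    fix e assume "e \<in> pairs V1 \<inter> pairs V2"
    then have "e \<subseteq> V1 \<inter> V2" "card e = 2" by (simp_all add: pairs_def)
    then show False using disj by simp
  qed
  have X: "\<not> e \<subseteq> V1 \<and> \<not> e \<subseteq> V2" if "e \<in> ?X" for e using that disj by auto
  have dX: "(pairs V1 \<union> pairs V2) \<inter> ?X = {}" using X by (auto simp: pairs_def)
  have "count ?G e = count G1 e + card V2" if "e \<in> pairs V1" for e
    using that d tcm_count_eq_0[OF G2, of e] count_crossing_inside[OF fin disj that] by auto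
  then have s1: "(\<Sum>e\<in>pairs V1. 2 ^ count ?G e) = weight V1 G1 * 2 ^ card V2"
    by (simp add: weight_def sum_distrib_right power_add del: count_union)
  have "count ?G e = count G2 e + card V1" if "e \<in> pairs V2" for e
    using that d tcm_count_eq_0[OF G1, of e] fin
      count_crossing_inside[of V2 V1 e, OF _ _ disj[unfolded Int_commute[of V1]]]
    unfolding crossing_commute[of V1 V2] by auto
  then have s2: "(\<Sum>e\<in>pairs V2. 2 ^ count ?G e) = weight V2 G2 * 2 ^ card V1"
    by (simp add: weight_def sum_distrib_right power_add del: count_union)
  have "count ?G e = 0" if "e \<in> ?X" for e
    using X[OF that] count_crossing_across[OF fin, of e] tcm_count_eq_0[OF G1, of e]
      tcm_count_eq_0[OF G2, of e] by (auto simp: pairs_def)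
  then have s3: "(\<Sum>e\<in>?X. 2 ^ count ?G e) = card V1 * card V2"
    using card_pairs_across[OF fin disj] by (simp del: count_union)
  have "weight (V1 \<union> V2) ?G = (\<Sum>e\<in>pairs V1 \<union> pairs V2. 2 ^ count ?G e) + (\<Sum>e\<in>?X. 2 ^ count ?G e)"
    unfolding weight_def pairs_Un[OF disj]
    using fin dX by (intro sum.union_disjoint) (auto simp: finite_pairs)
  also have "(\<Sum>e\<in>pairs V1 \<union> pairs V2. 2 ^ count ?G e) =
      (\<Sum>e\<in>pairs V1. 2 ^ count ?G e) + (\<Sum>e\<in>pairs V2. 2 ^ count ?G e)"
    using fin d by (intro sum.union_disjoint) (auto simp: finite_pairs)
  finally show ?thesis by (simp only: s1 s2 s3)
qed

section \<open>The explicit recursion\<close>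

text \<open>For \<open>m >= 2\<close> this is the power \<open>2 ^ k\<close> of the theorem: from
  \<open>m = 4\<close> on, halving \<open>m\<close> lowers \<open>k\<close> by one. The value 1 at 1
  makes \<open>split_size 3 = 2\<close> come out right.\<close>

fun split_size :: "nat \<Rightarrow> nat" where
  "split_size m = (if m < 3 then 1 else 2 * split_size (m div 2))"

declare split_size.simps [simp del]

lemma split_size_bounds:
  assumes "m \<ge> 2"
  shows "\<exists>k. split_size m = 2 ^ k" "3 * split_size m \<le> 2 * m" "m < 3 * split_size m"
proof -
  have "(\<exists>k. split_size m = 2 ^ k) \<and> 3 * split_size m \<le> 2 * m \<and> m < 3 * split_size m"
    using assms
  proof (induction m rule: split_size.induct)
    case (1 m)
    consider "m = 2" | "m = 3" | "m \<ge> 4" using 1 by linarith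
    then show ?case
    proof cases
      case 3
      then have "(\<exists>k. split_size (m div 2) = 2 ^ k) \<and> 3 * split_size (m div 2) \<le> 2 * (m div 2)
          \<and> m div 2 < 3 * split_size (m div 2)"
        using 1 by simp
      moreover have "split_size m = 2 * split_size (m div 2)"
        using 3 by (subst split_size.simps) simp
      moreover from this have "\<exists>k. split_size m = 2 ^ k" if "split_size (m div 2) = 2 ^ k" for k
        using that by (intro exI[of _ "Suc k"]) simp
      ultimately show ?thesis by auto
    qed (auto simp: split_size.simps intro: exI[of _ 0] exI[of _ 1])
  qed
  then show "\<exists>k. split_size m = 2 ^ k" "3 * split_size m \<le> 2 * m" "m < 3 * split_size m" by auto
qed

lemma power_two_interval_unique:
  fixes j k :: nat
  assumes "3 * 2 ^ j \<le> 2 * m" "m < 3 * 2 ^ j" "3 * 2 ^ k \<le> 2 * m" "m < 3 * (2 ^ k :: nat)"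
  shows "j = k"
proof -
  have "(2::nat) ^ j < 2 ^ Suc k" "(2::nat) ^ k < 2 ^ Suc j" using assms by simp_all
  then show ?thesis by (simp only: power_strict_increasing_iff) 
qed

lemma split_size_eqI:
  assumes "3 * 2 ^ k \<le> 2 * m" "m < 3 * 2 ^ k"
  shows "split_size m = 2 ^ k"
proof -
  have "(1::nat) \<le> 2 ^ k" by simp
  then have "m \<ge> 2" using assms by linarith
  with assms split_size_bounds[of m] power_two_interval_unique[of _ m k] show ?thesis by metis
qed

text \<open>At 6 the general rule, with parts 4 and 2, would give 72; parts 3 and 3 give 73.\<close>

function opt :: "nat \<Rightarrow> nat" where
  "opt m = (if m \<le> 1 then 0 else if m = 6 then 73 else
     opt (split_size m) * 2 ^ (m - split_size m) + opt (m - split_size m) * 2 ^ split_size m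
     + split_size m * (m - split_size m))"
  by auto
termination
proof (relation "measure id")
  fix m :: nat assume "\<not> m \<le> 1"
  then have "m \<ge> 2" by simp
  from split_size_bounds[OF this] this
  show "(split_size m, m) \<in> measure id" "(m - split_size m, m) \<in> measure id" by auto
qed simp

declare opt.simps [simp del]

definition dens :: "nat \<Rightarrow> real" where "dens n = real n / 2 ^ n"

text \<open>With the normalisation by \<open>2 ^ n\<close>, joining parts of sizes \<open>a\<close> and \<open>b\<close> adds exactly
  \<open>dens a * dens b\<close>.\<close>

definition nopt :: "nat \<Rightarrow> real" where "nopt n = real (opt n) / 2 ^ n"

lemma nopt_join:
  assumes "opt (a + b) = opt a * 2 ^ b + opt b * 2 ^ a + a * b"
  shows "nopt (a + b) = nopt a + nopt b + dens a * dens b"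
  unfolding nopt_def dens_def assms by (simp add: field_simps power_add)

lemma nopt_join_le_iff:
  "nopt a + nopt b + dens a * dens b \<le> nopt (a + b) \<longleftrightarrow>
   opt a * 2 ^ b + opt b * 2 ^ a + a * b \<le> opt (a + b)"
proof -
  have "nopt a + nopt b + dens a * dens b = real (opt a * 2 ^ b + opt b * 2 ^ a + a * b) / 2 ^ (a + b)"
    unfolding nopt_def dens_def by (simp add: field_simps power_add)
  then have "nopt a + nopt b + dens a * dens b \<le> nopt (a + b) \<longleftrightarrow>
     real (opt a * 2 ^ b + opt b * 2 ^ a + a * b) \<le> real (opt (a + b))"
    unfolding nopt_def by (simp only: divide_le_cancel) simp
  then show ?thesis by (simp only: of_nat_le_iff)
qed

lemma opt_split:
  assumes "3 * 2 ^ k \<le> 2 * m" "m < 3 * 2 ^ k" "m \<noteq> 6"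
  shows "opt m = opt (2 ^ k) * 2 ^ (m - 2 ^ k) + opt (m - 2 ^ k) * 2 ^ (2 ^ k) + 2 ^ k * (m - 2 ^ k)"
proof -
  have "(1::nat) \<le> 2 ^ k" by simp
  then have "m \<ge> 2" using assms by linarith
  with assms show ?thesis by (subst opt.simps) (simp add: split_size_eqI)
qed

text \<open>For \<open>m = p + q\<close> the conditions on \<open>p\<close> and \<open>q\<close> are
  the interval conditions \<open>3 * p <= 2 * m\<close> and \<open>m < 3 * p\<close>, in a form that
  can be read off the sizes of the pieces.\<close>

lemma nopt_split:
  assumes "p = 2 ^ k" "p \<le> 2 * q" "q < 2 * p" "p + q \<noteq> 6"
  shows "nopt (p + q) = nopt p + nopt q + dens p * dens q"
  using opt_split[of k "p + q"] assms by (intro nopt_join) simp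

lemma opt_table:
  "opt 1 = 0" "opt 2 = 1" "opt 3 = 4" "opt 4 = 12" "opt 5 = 30"
  "opt 6 = 73" "opt 7 = 172" "opt 8 = 400" "opt 9 = 884" "opt 10 = 1960"
  "opt 11 = 4316" "opt 12 = 9504" "opt 13 = 20520" "opt 14 = 44336" "opt 15 = 95288"
  "opt 16 = 204864" "opt 17 = 431176" "opt 18 = 911440" "opt 19 = 1924184" "opt 20 = 4071520"
  "opt 21 = 8530024" "opt 22 = 17903728"
proof -
  show o1: "opt 1 = 0" and o6: "opt 6 = 73" by (simp_all add: opt.simps)
  show o2: "opt 2 = 1" using opt_split[of 0 2] o1 by simp
  show o3: "opt 3 = 4" using opt_split[of 1 3] o1 o2 by simp
  show o4: "opt 4 = 12" using opt_split[of 1 4] o2 by simp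
  show o5: "opt 5 = 30" using opt_split[of 1 5] o2 o3 by simp
  show o7: "opt 7 = 172" using opt_split[of 2 7] o3 o4 by simp
  show o8: "opt 8 = 400" using opt_split[of 2 8] o4 by simp
  show o9: "opt 9 = 884" using opt_split[of 2 9] o4 o5 by simp
  show o10: "opt 10 = 1960" using opt_split[of 2 10] o4 o6 by simp
  show o11: "opt 11 = 4316" using opt_split[of 2 11] o4 o7 by simp
  show o12: "opt 12 = 9504" using opt_split[of 3 12] o4 o8 by simp
  show o13: "opt 13 = 20520" using opt_split[of 3 13] o5 o8 by simp
  show o14: "opt 14 = 44336" using opt_split[of 3 14] o6 o8 by simp
  show o15: "opt 15 = 95288" using opt_split[of 3 15] o7 o8 by simp
  show o16: "opt 16 = 204864" using opt_split[of 3 16] o8 by simp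
  show o17: "opt 17 = 431176" using opt_split[of 3 17] o8 o9 by simp
  show o18: "opt 18 = 911440" using opt_split[of 3 18] o8 o10 by simp
  show o19: "opt 19 = 1924184" using opt_split[of 3 19] o8 o11 by simp
  show o20: "opt 20 = 4071520" using opt_split[of 3 20] o8 o12 by simp
  show o21: "opt 21 = 8530024" using opt_split[of 3 21] o8 o13 by simp
  show o22: "opt 22 = 17903728" using opt_split[of 3 22] o8 o14 by simp
qed

text \<open>Beyond 22 the larger of two parts splits off a power of two that is at least 8, as the
  estimates for \<open>dens\<close> require, and the exceptional value at 6 no longer interferes.\<close>

lemma opt_superadditive_small:
  assumes "1 \<le> a" "1 \<le> b" "a + b \<le> 22"
  shows "opt a * 2 ^ b + opt b * 2 ^ a + a * b \<le> opt (a + b)"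
proof -
  have "\<forall>a\<in>set [1..<22]. \<forall>b\<in>set [1..<23 - a]. opt a * 2 ^ b + opt b * 2 ^ a + a * b \<le> opt (a + b)"
    by (simp add: upt_rec_numeral upt_rec[of 1] opt_table del: set_upt One_nat_def)
  then show ?thesis using assms by (auto simp: Ball_def)
qed

section \<open>Superadditivity\<close>

lemma dens_nonneg: "0 \<le> dens n"
  by (simp add: dens_def)

lemma dens_Suc_le: "n \<ge> 1 \<Longrightarrow> dens (Suc n) \<le> dens n"
  by (simp add: dens_def field_simps)

lemma dens_antimono:
  assumes "1 \<le> m" "m \<le> n"
  shows "dens n \<le> dens m"
  using assms(2,1)
proof (induction n rule: dec_induct)
  case (step n)
  then have "dens (Suc n) \<le> dens n" by (intro dens_Suc_le) simp
  with step show ?case by simp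
qed simp

text \<open>One step multiplies \<open>dens m\<close> by \<open>(m + 1) / (2 * m)\<close>, which is
  at most 5/8 for \<open>m >= 4\<close>.\<close>

lemma dens_less:
  assumes "4 \<le> m" "m < n"
  shows "dens n \<le> 5 / 8 * dens m"
proof -
  have "dens n \<le> dens (Suc m)" using assms by (intro dens_antimono) simp_all
  also have "\<dots> \<le> 5 / 8 * dens m" using assms by (simp add: dens_def field_simps)
  finally show ?thesis .
qed

text \<open>Four steps multiply \<open>dens m\<close> by \<open>(m + 4) / (16 * m)\<close>, which is
  at most 1/8 for \<open>m >= 4\<close>.\<close>

lemma dens_much_less:
  assumes "4 \<le> m" "m + 4 \<le> n"
  shows "dens n \<le> dens m / 8"
proof -
  have "dens n \<le> dens (m + 4)" using assms by (intro dens_antimono) simp_all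
  also have "\<dots> \<le> dens m / 8" using assms by (simp add: dens_def field_simps power_add)
  finally show ?thesis .
qed

lemma dens_mult_mono:
  assumes "a + b = c + d" "a * b \<le> c * d"
  shows "dens a * dens b \<le> dens c * dens d"
proof -
  have "dens x * dens y = real (x * y) / 2 ^ (x + y)" for x y
    by (simp add: dens_def power_add)
  then show ?thesis using assms by (simp only:) (intro divide_right_mono; simp add: of_nat_mult[symmetric] del: of_nat_mult)
qed

section \<open>Inequalities for rotation and exchange of pieces\<close>

text \<open>Cross-multiplied monotonicity of \<open>n / (2 ^ n - 1)\<close>. Raising
  \<open>p\<close> by one adds \<open>2 ^ r - 1\<close> on the left and \<open>r * 2 ^ p\<close> on
  the right.\<close>

lemma mersenne_over_mono:
  assumes "1 \<le> r" "r \<le> p"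
  shows "real p * (2 ^ r - 1) \<le> real r * (2 ^ p - 1)"
  using assms(2)
proof (induction p rule: dec_induct)
  case (step p)
  have "(2::real) ^ r \<le> 2 ^ p" using step by (intro power_increasing) simp_all
  moreover have "1 * (2::real) ^ p \<le> real r * 2 ^ p" using assms(1) by (intro mult_right_mono) simp_all
  ultimately have "(2::real) ^ r - 1 \<le> real r * 2 ^ p" by linarith
  with step show ?case by (simp add: algebra_simps)
qed simp

text \<open>Compares the surplus of \<open>((p, q), r)\<close> with that of
  \<open>(p, (q, r))\<close>: over the denominator \<open>2 ^ (p + q + r)\<close> they differ by
  \<open>q\<close> times the difference in \<open>mersenne_over_mono\<close>.\<close>

lemma dens_rotate:
  assumes "1 \<le> r" "r \<le> p"
  shows "dens p * dens q + dens (p + q) * dens r \<le> dens q * dens r + dens p * dens (q + r)"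
proof -
  have "dens q * dens r + dens p * dens (q + r) - (dens p * dens q + dens (p + q) * dens r)
     = real q * (real r * (2 ^ p - 1) - real p * (2 ^ r - 1)) / 2 ^ (p + q + r)"
    by (simp add: dens_def field_simps power_add)
  also have "\<dots> \<ge> 0" using mersenne_over_mono[OF assms] by simp
  finally show ?thesis by simp
qed

text \<open>Rearranged: \<open>n / (2 ^ n + 1)\<close> is no larger at \<open>p\<close> than at any
  \<open>a <= p\<close>. This quotient still grows from 1/3 at 1 to 2/5 at 2, so the induction
  starts at \<open>p = 4\<close>, where all \<open>a\<close> are checked.\<close>

lemma pow_diff_ge:
  assumes "4 \<le> p" "1 \<le> a" "a \<le> p"
  shows "real p - real a \<le> real a * 2 ^ p - real p * 2 ^ a"
  using assms(3)
proof (cases "a = p")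
  case False
  have "\<forall>a. 1 \<le> a \<and> a \<le> p \<longrightarrow> real p * (2 ^ a + 1) \<le> real a * (2 ^ p + 1)"
    using assms(1)
  proof (induction p rule: dec_induct)
    case base
    have "a \<in> {1, 2, 3, 4}" if "1 \<le> a \<and> a \<le> 4" for a :: nat using that by auto
    then show ?case by fastforce
  next
    case (step p)
    show ?case
    proof (intro allI impI)
      fix a assume a: "1 \<le> a \<and> a \<le> Suc p"
      show "real (Suc p) * (2 ^ a + 1) \<le> real a * (2 ^ Suc p + 1)"
      proof (cases "a = Suc p")
        case False
        with a have a': "1 \<le> a" "a \<le> p" by simp_all
        have IH: "real p * (2 ^ a + 1) \<le> real a * (2 ^ p + 1)" using step.IH a' by blast
        have "(2::real) ^ a + 1 \<le> real a * 2 ^ p"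
        proof (cases "a = 1")
          case True
          have "(2::real) ^ 4 \<le> 2 ^ p" using step.hyps by (intro power_increasing) simp_all
          with True show ?thesis by simp
        next
          case False
          with a' have "2 * (2::real) ^ p \<le> real a * 2 ^ p" by (intro mult_right_mono) simp_all
          moreover have "(2::real) ^ a \<le> 2 ^ p" using a' by (intro power_increasing) simp_all
          moreover have "(1::real) \<le> 2 ^ p" by simp
          ultimately show ?thesis by linarith
        qed
        with IH show ?thesis by (simp add: algebra_simps)
      qed simp
    qed
  qed
  with assms show ?thesis by (fastforce simp: algebra_simps)
qed simp

text \<open>Regroups \<open>((p, a), (p, b))\<close> as \<open>((p, p), (a, b))\<close>. The inner
  joins change by \<open>(dens p - dens a) * (dens p - dens b)\<close>, which is
  \<open>x * y\<close> over the common denominator, the outer join by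
  \<open>- (p - a) * (p - b)\<close>. On one side of \<open>p\<close> the factors have equal signs
  and \<open>pow_diff_ge\<close> makes the former dominate.\<close>

lemma dens_exchange:
  assumes "4 \<le> p" "1 \<le> a" "1 \<le> b" "a \<le> p \<and> b \<le> p \<or> p \<le> a \<and> p \<le> b"
  shows "dens p * dens a + dens p * dens b + dens (p + a) * dens (p + b)
    \<le> dens p * dens p + dens a * dens b + dens (p + p) * dens (a + b)"
proof -
  define x y where "x = real a * 2 ^ p - real p * 2 ^ a" and "y = real b * 2 ^ p - real p * 2 ^ b"
  have "dens p * dens p + dens a * dens b + dens (p + p) * dens (a + b)
     - (dens p * dens a + dens p * dens b + dens (p + a) * dens (p + b))
     = (x * y - (real p - real a) * (real p - real b)) / 2 ^ (p + p + a + b)"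
    by (simp add: x_def y_def dens_def field_simps power_add)
  moreover have "(real p - real a) * (real p - real b) \<le> x * y"
    using assms(4)
  proof
    assume "a \<le> p \<and> b \<le> p"
    with assms pow_diff_ge[of p a] pow_diff_ge[of p b] show ?thesis
      unfolding x_def y_def by (intro mult_mono) auto
  next
    assume le: "p \<le> a \<and> p \<le> b"
    \<comment> \<open>The differences to \<open>p\<close> are nonpositive here, so
      \<open>pow_diff_ge\<close> is used with its two arguments in swapped roles.\<close>
    have "(real a - real p) * (real b - real p) \<le> (- x) * (- y)"
      using assms le pow_diff_ge[of a p] pow_diff_ge[of b p]
      unfolding x_def y_def by (intro mult_mono) auto
    then show ?thesis by (simp add: algebra_simps)
  qed
  ultimately show ?thesis by (smt (verit) divide_nonneg_nonneg zero_le_power)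
qed

section \<open>Regrouping two parts that are themselves split\<close>

text \<open>The hypothesis of the induction on the total, made a predicate so that the cases of its
  step can be separate lemmas.\<close>

definition superadditive_below :: "nat \<Rightarrow> bool" where
  "superadditive_below m \<longleftrightarrow> (\<forall>x y. 1 \<le> x \<longrightarrow> 1 \<le> y \<longrightarrow> x + y < m \<longrightarrow>
     nopt x + nopt y + dens x * dens y \<le> nopt (x + y))"

lemma superadditive_belowD:
  "superadditive_below m \<Longrightarrow> 1 \<le> x \<Longrightarrow> 1 \<le> y \<Longrightarrow> x + y < m \<Longrightarrow>
     nopt x + nopt y + dens x * dens y \<le> nopt (x + y)"
  by (simp add: superadditive_below_def)

text \<open>Over the integers \<open>c * e - s * n\<close> equals \<open>(c - s) * (e - s)\<close>;
  here both factors are nonnegative.\<close>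

lemma mult_le_mult_of_le_sum:
  fixes c e n s :: nat
  assumes "c + e = s + n" "s \<le> c" "s \<le> e" 
  shows "s * n \<le> c * e"
proof -
  obtain x y where "c = s + x" "e = s + y" using assms(2,3) le_Suc_ex by metis
  moreover from this assms have "n = s + x + y" by simp
  ultimately show ?thesis by (simp add: algebra_simps)
qed

text \<open>The same identity with both factors nonpositive.\<close>

lemma mult_le_mult_of_sum_le:
  fixes c e n s :: nat
  assumes "c + e = s + n" "c \<le> s" "e \<le> s"
  shows "s * n \<le> c * e"
proof -
  obtain x y where "s = c + x" "s = e + y" using assms(2,3) le_Suc_ex by metis
  moreover from this assms have "e = n + x" "c = n + y" by simp_all
  ultimately show ?thesis by (simp add: algebra_simps)
qed

text \<open>The splits that survive rotation. The power of two split off from the larger part is \<open>P\<close>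
  or \<open>2 * S\<close>; the smaller part splits off the same power (\<open>same_scale\<close>) or half of it
  (\<open>half_scale\<close>). In each case the remainders are merged below the powers of two
  that the optimal split of the sum separates off.\<close>

lemma join_same_scale:
  assumes P: "P = 2 ^ k" "8 \<le> P" and a: "P \<le> 2 * a" "a < 2 * P" and b: "P \<le> 2 * b" "b < 2 * P"
    and side: "a \<le> P \<and> b \<le> P \<or> P \<le> a \<and> P \<le> b"
    and IH: "superadditive_below (P + a + (P + b))"
  shows "nopt (P + a) + nopt (P + b) + dens (P + a) * dens (P + b) \<le> nopt (P + a + (P + b))"
proof -
  \<comment> \<open>The new grouping is \<open>((P, P), (a, b))\<close>, with \<open>2 * P\<close>
    as the power of two of the total.\<close>
  have "P + a + (P + b) = (P + P) + (a + b)" by simp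
  moreover have "nopt ((P + P) + (a + b)) = nopt (P + P) + nopt (a + b) + dens (P + P) * dens (a + b)"
    using assms by (intro nopt_split[of _ "Suc k"]) auto
  moreover have "nopt (P + P) = nopt P + nopt P + dens P * dens P"
    "nopt (P + a) = nopt P + nopt a + dens P * dens a"
    "nopt (P + b) = nopt P + nopt b + dens P * dens b"
    using assms by (intro nopt_split[of _ k]; simp)+
  moreover have "nopt a + nopt b + dens a * dens b \<le> nopt (a + b)"
    using assms by (intro superadditive_belowD[OF IH]) auto
  moreover have "dens P * dens a + dens P * dens b + dens (P + a) * dens (P + b)
    \<le> dens P * dens P + dens a * dens b + dens (P + P) * dens (a + b)"
    using assms by (intro dens_exchange) auto
  ultimately show ?thesis by (simp add: algebra_simps del: zero_le_square)
qed

text \<open>\<open>((P, (P, c)), (P, e))\<close> becomes \<open>((P, P), (P, (c, e)))\<close>.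
  Besides the nonnegative \<open>(dens c - dens P) * (dens e - dens P)\<close> there is a gain
  \<open>dens P * dens (c + e)\<close>, and the losses are at most 5/8 + 5/64 of it.\<close>

lemma join_same_scale_large_small:
  assumes P: "P = 2 ^ k" "8 \<le> P" and c: "P \<le> 2 * c" "c < P" and e: "P \<le> 2 * e" "e < P"
    and IH: "superadditive_below (P + (P + c) + (P + e))"
  shows "nopt (P + (P + c)) + nopt (P + e) + dens (P + (P + c)) * dens (P + e)
    \<le> nopt (P + (P + c) + (P + e))"
proof -
  have "P + (P + c) + (P + e) = (P + P) + (P + (c + e))" by simp
  moreover have "nopt ((P + P) + (P + (c + e))) =
      nopt (P + P) + nopt (P + (c + e)) + dens (P + P) * dens (P + (c + e))"
    using assms by (intro nopt_split[of _ "Suc k"]) auto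
  moreover have "nopt (P + P) = nopt P + nopt P + dens P * dens P"
    "nopt (P + (P + c)) = nopt P + nopt (P + c) + dens P * dens (P + c)"
    "nopt (P + c) = nopt P + nopt c + dens P * dens c"
    "nopt (P + e) = nopt P + nopt e + dens P * dens e"
    "nopt (P + (c + e)) = nopt P + nopt (c + e) + dens P * dens (c + e)"
    using assms by (intro nopt_split[of _ k]; simp)+
  moreover have "nopt c + nopt e + dens c * dens e \<le> nopt (c + e)"
    using assms by (intro superadditive_belowD[OF IH]) auto
  moreover have "0 \<le> (dens c - dens P) * (dens e - dens P)"
    using assms by (intro mult_nonneg_nonneg) (auto intro: dens_antimono)
  moreover have c5: "dens (P + c) \<le> 5 / 8 * dens (c + e)"
    using assms by (intro dens_less) auto
  then have "dens P * dens (P + c) \<le> dens P * (5 / 8 * dens (c + e))"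
    by (intro mult_left_mono dens_nonneg)
  moreover have "dens (P + (P + c)) \<le> dens (P + c) / 8"
    using assms by (intro dens_much_less) auto
  then have "dens (P + (P + c)) * dens (P + e) \<le> (5 / 64 * dens (c + e)) * dens P"
    using assms c5 by (intro mult_mono dens_antimono) (auto simp: dens_nonneg)
  moreover have "0 \<le> dens P * dens (c + e)" "0 \<le> dens (P + P) * dens (P + (c + e))"
    by (simp_all add: dens_nonneg)
  ultimately show ?thesis by (simp add: algebra_simps del: zero_le_square)
qed

text \<open>Trading \<open>c\<close>, \<open>e\<close> for \<open>S\<close>, \<open>n\<close> does
  not lower the sum of \<open>nopt\<close>: \<open>S + n\<close> is split optimally and
  \<open>dens S * dens n <= dens c * dens e\<close>. The two \<open>S\<close> then form a third
  \<open>2 * S\<close>. The gain \<open>dens S * dens S\<close> beats losses of at most 5/8 + 1/8 +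
  1/64 of it; \<open>dens (2 * S) * dens (S + c)\<close> is offset by joining two
  \<open>2 * S\<close>.\<close>

lemma join_same_scale_medium_small_low:
  assumes S: "S = 2 ^ k" "4 \<le> S" and c: "S < c" "c < 2 * S" and e: "S \<le> e" "e < 2 * S"
    and n: "c + e = S + n" "n < 2 * S"
    and IH: "superadditive_below (2 * S + (S + c) + (2 * S + e))"
  shows "nopt (2 * S + (S + c)) + nopt (2 * S + e) + dens (2 * S + (S + c)) * dens (2 * S + e)
    \<le> nopt (2 * S + (S + c) + (2 * S + e))"
proof -
  have "2 * S + (S + c) + (2 * S + e) = (2 * S + 2 * S) + (2 * S + n)" using n by simp
  moreover have "nopt ((2 * S + 2 * S) + (2 * S + n)) =
      nopt (2 * S + 2 * S) + nopt (2 * S + n) + dens (2 * S + 2 * S) * dens (2 * S + n)"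
    using assms by (intro nopt_split[of _ "Suc (Suc k)"]) auto
  moreover have "nopt (2 * S + 2 * S) = nopt (2 * S) + nopt (2 * S) + dens (2 * S) * dens (2 * S)"
    "nopt (2 * S + n) = nopt (2 * S) + nopt n + dens (2 * S) * dens n"
    "nopt (2 * S + (S + c)) = nopt (2 * S) + nopt (S + c) + dens (2 * S) * dens (S + c)"
    "nopt (2 * S + e) = nopt (2 * S) + nopt e + dens (2 * S) * dens e"
    using assms by (intro nopt_split[of _ "Suc k"]; auto)+
  moreover have "nopt (S + S) = nopt S + nopt S + dens S * dens S"
    "nopt (S + c) = nopt S + nopt c + dens S * dens c"
    "nopt (S + n) = nopt S + nopt n + dens S * dens n"
    using assms by (intro nopt_split[of _ k]; auto)+
  moreover have "S + S = 2 * S" by simp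
  moreover have "nopt c + nopt e + dens c * dens e \<le> nopt (S + n)"
    unfolding n(1)[symmetric] using assms by (intro superadditive_belowD[OF IH]) auto
  moreover have "dens S * dens n \<le> dens c * dens e"
    using assms by (intro dens_mult_mono mult_le_mult_of_le_sum) auto
  moreover have "dens S * dens c \<le> dens S * (5 / 8 * dens S)"
    using assms by (intro mult_left_mono dens_less dens_nonneg) auto
  moreover have "dens (2 * S) * dens (S + c) \<le> dens (2 * S) * dens (2 * S)"
    using assms by (intro mult_left_mono dens_antimono dens_nonneg) auto
  moreover have "dens (2 * S) * dens e \<le> (dens S / 8) * dens S"
    using assms by (intro mult_mono dens_much_less dens_antimono) (auto simp: dens_nonneg)
  moreover have "dens (2 * S + (S + c)) * dens (2 * S + e) \<le> (dens S / 8) * (dens S / 8)"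
    using assms by (intro mult_mono dens_much_less) (auto simp: dens_nonneg)
  moreover have "0 \<le> dens S * dens S" "0 \<le> dens (2 * S) * dens n"
      "0 \<le> dens (2 * S + 2 * S) * dens (2 * S + n)"
    by (simp_all add: dens_nonneg)
  ultimately show ?thesis by (simp del: zero_le_square)
qed

text \<open>Here \<open>c + e\<close> suffices to trade \<open>c\<close>, \<open>e\<close> for
  \<open>2 * S\<close>, \<open>t\<close>, giving \<open>((2 * S, 2 * S), (2 * S, (S, t)))\<close>.
  The gain \<open>dens S * dens t\<close> beats losses of at most 5/8 + 5/64 + 1/8 of it.\<close>

lemma join_same_scale_medium_small_high:
  assumes S: "S = 2 ^ k" "4 \<le> S" and c: "S < c" "c < 2 * S" and e: "S \<le> e" "e < 2 * S"
    and t: "c + e = 2 * S + t" "S \<le> t"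
    and IH: "superadditive_below (2 * S + (S + c) + (2 * S + e))"
  shows "nopt (2 * S + (S + c)) + nopt (2 * S + e) + dens (2 * S + (S + c)) * dens (2 * S + e)
    \<le> nopt (2 * S + (S + c) + (2 * S + e))"
proof -
  have "2 * S + (S + c) + (2 * S + e) = (2 * S + 2 * S) + (2 * S + (S + t))" using t by simp
  moreover have "nopt ((2 * S + 2 * S) + (2 * S + (S + t))) =
      nopt (2 * S + 2 * S) + nopt (2 * S + (S + t)) + dens (2 * S + 2 * S) * dens (2 * S + (S + t))"
    using assms by (intro nopt_split[of _ "Suc (Suc k)"]) auto
  moreover have "nopt (2 * S + 2 * S) = nopt (2 * S) + nopt (2 * S) + dens (2 * S) * dens (2 * S)"
    "nopt (2 * S + (S + t)) = nopt (2 * S) + nopt (S + t) + dens (2 * S) * dens (S + t)"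
    "nopt (2 * S + t) = nopt (2 * S) + nopt t + dens (2 * S) * dens t"
    "nopt (2 * S + (S + c)) = nopt (2 * S) + nopt (S + c) + dens (2 * S) * dens (S + c)"
    "nopt (2 * S + e) = nopt (2 * S) + nopt e + dens (2 * S) * dens e"
    using assms by (intro nopt_split[of _ "Suc k"]; auto)+
  moreover have "nopt (S + t) = nopt S + nopt t + dens S * dens t"
    "nopt (S + c) = nopt S + nopt c + dens S * dens c"
    using assms by (intro nopt_split[of _ k]; auto)+
  moreover have "nopt c + nopt e + dens c * dens e \<le> nopt (2 * S + t)"
    unfolding t(1)[symmetric] using assms by (intro superadditive_belowD[OF IH]) auto
  moreover have "dens (2 * S) * dens t \<le> dens c * dens e"
    using assms by (intro dens_mult_mono mult_le_mult_of_sum_le) auto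
  moreover have "dens S * dens c \<le> dens S * (5 / 8 * dens t)"
    using assms by (intro mult_left_mono dens_less dens_nonneg) auto
  moreover have "dens (2 * S) * dens (S + c) \<le> dens (2 * S) * dens (2 * S)"
    using assms by (intro mult_left_mono dens_antimono dens_nonneg) auto
  moreover have "dens (2 * S) * dens e \<le> (dens S / 8) * (5 / 8 * dens t)"
    using assms by (intro mult_mono dens_much_less dens_less) (auto simp: dens_nonneg)
  moreover have "dens (2 * S + (S + c)) * dens (2 * S + e) \<le> (dens S / 8) * dens t"
    using assms by (intro mult_mono dens_much_less dens_antimono) (auto simp: dens_nonneg)
  moreover have "0 \<le> dens S * dens t" "0 \<le> dens (2 * S) * dens (S + t)"
      "0 \<le> dens (2 * S + 2 * S) * dens (2 * S + (S + t))"
    by (simp_all add: dens_nonneg)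
  ultimately show ?thesis by (simp del: zero_le_square)
qed

text \<open>Swapping \<open>c\<close> with the \<open>S\<close> of the smaller part gives
  \<open>((2 * S, (S, S)), (c, e))\<close>. As \<open>c\<close> and \<open>e\<close> exceed
  \<open>S\<close> strictly, \<open>(dens S - dens c) * (dens S - dens e)\<close> is at least 9/64
  of \<open>dens S * dens S\<close>, and the old outer join is worth at most 1/64 of it.\<close>

lemma join_half_scale_large:
  assumes S: "S = 2 ^ k" "4 \<le> S" and c: "S < c" "c < 2 * S" and e: "S < e" "e < 2 * S"
    and IH: "superadditive_below (2 * S + (S + c) + (S + e))"
  shows "nopt (2 * S + (S + c)) + nopt (S + e) + dens (2 * S + (S + c)) * dens (S + e)
    \<le> nopt (2 * S + (S + c) + (S + e))"
proof -
  have "2 * S + (S + c) + (S + e) = (2 * S + 2 * S) + (c + e)" by simp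
  moreover have "nopt ((2 * S + 2 * S) + (c + e)) =
      nopt (2 * S + 2 * S) + nopt (c + e) + dens (2 * S + 2 * S) * dens (c + e)"
    using assms by (intro nopt_split[of _ "Suc (Suc k)"]) auto
  moreover have "nopt (2 * S + 2 * S) = nopt (2 * S) + nopt (2 * S) + dens (2 * S) * dens (2 * S)"
    "nopt (2 * S + (S + c)) = nopt (2 * S) + nopt (S + c) + dens (2 * S) * dens (S + c)"
    using assms by (intro nopt_split[of _ "Suc k"]; auto)+
  moreover have "nopt (S + S) = nopt S + nopt S + dens S * dens S"
    "nopt (S + c) = nopt S + nopt c + dens S * dens c"
    "nopt (S + e) = nopt S + nopt e + dens S * dens e"
    using assms by (intro nopt_split[of _ k]; auto)+
  moreover have "S + S = 2 * S" by simp
  moreover have "nopt c + nopt e + dens c * dens e \<le> nopt (c + e)"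
    using assms by (intro superadditive_belowD[OF IH]) auto
  moreover have "(3 / 8 * dens S) * (3 / 8 * dens S) \<le> (dens S - dens c) * (dens S - dens e)"
    using assms dens_less[of S c] dens_less[of S e] dens_nonneg[of S] by (intro mult_mono) auto
  moreover have "dens (2 * S) * dens (S + c) \<le> dens (2 * S) * dens (2 * S)"
    using assms by (intro mult_left_mono dens_antimono dens_nonneg) auto
  moreover have "dens (2 * S + (S + c)) * dens (S + e) \<le> (dens S / 8) * (dens S / 8)"
    using assms by (intro mult_mono dens_much_less) (auto simp: dens_nonneg)
  moreover have "0 \<le> dens S * dens S" "0 \<le> dens (2 * S + 2 * S) * dens (c + e)"
    by (simp_all add: dens_nonneg)
  ultimately show ?thesis by (simp add: algebra_simps del: zero_le_square)
qed

text \<open>Trading \<open>c\<close>, \<open>e\<close> for \<open>2 * S\<close>, \<open>t\<close>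
  gives \<open>((2 * S, 2 * S), (S, t))\<close>; the losses are again at most 5/8 + 5/64 + 1/8 of
  the gain \<open>dens S * dens t\<close>.\<close>

lemma join_half_scale_high:
  assumes S: "S = 2 ^ k" "4 \<le> S" and c: "S \<le> c" "c < 2 * S" and e: "S < e" "e < 2 * S"
    and t: "c + e = 2 * S + t" "S \<le> t"
    and IH: "superadditive_below (2 * S + c + (S + e))"
  shows "nopt (2 * S + c) + nopt (S + e) + dens (2 * S + c) * dens (S + e)
    \<le> nopt (2 * S + c + (S + e))"
proof -
  have "2 * S + c + (S + e) = (2 * S + 2 * S) + (S + t)" using t by simp
  moreover have "nopt ((2 * S + 2 * S) + (S + t)) =
      nopt (2 * S + 2 * S) + nopt (S + t) + dens (2 * S + 2 * S) * dens (S + t)"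
    using assms by (intro nopt_split[of _ "Suc (Suc k)"]) auto
  moreover have "nopt (2 * S + 2 * S) = nopt (2 * S) + nopt (2 * S) + dens (2 * S) * dens (2 * S)"
    "nopt (2 * S + t) = nopt (2 * S) + nopt t + dens (2 * S) * dens t"
    "nopt (2 * S + c) = nopt (2 * S) + nopt c + dens (2 * S) * dens c"
    using assms by (intro nopt_split[of _ "Suc k"]; auto)+
  moreover have "nopt (S + t) = nopt S + nopt t + dens S * dens t"
    "nopt (S + e) = nopt S + nopt e + dens S * dens e"
    using assms by (intro nopt_split[of _ k]; auto)+
  moreover have "nopt c + nopt e + dens c * dens e \<le> nopt (2 * S + t)"
    unfolding t(1)[symmetric] using assms by (intro superadditive_belowD[OF IH]) auto
  moreover have "dens (2 * S) * dens t \<le> dens c * dens e"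
    using assms by (intro dens_mult_mono mult_le_mult_of_sum_le) auto
  moreover have "dens S * dens e \<le> dens S * (5 / 8 * dens t)"
    using assms by (intro mult_left_mono dens_less dens_nonneg) auto
  moreover have "dens (2 * S) * dens c \<le> (dens S / 8) * (5 / 8 * dens t)"
    using assms by (intro mult_mono dens_much_less dens_less) (auto simp: dens_nonneg)
  moreover have "dens (2 * S + c) * dens (S + e) \<le> (dens S / 8) * dens t"
    using assms by (intro mult_mono dens_much_less dens_antimono) (auto simp: dens_nonneg)
  moreover have "0 \<le> dens S * dens t" "0 \<le> dens (2 * S) * dens (2 * S)"
      "0 \<le> dens (2 * S + 2 * S) * dens (S + t)"
    by (simp_all add: dens_nonneg)
  ultimately show ?thesis by (simp del: zero_le_square)
qed

text \<open>The total stays below \<open>6 * S\<close>, so its optimal split is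
  \<open>(2 * S, (2 * S, n))\<close>. Trading \<open>c\<close>, \<open>e\<close> for
  \<open>S\<close>, \<open>n\<close> frees an \<open>S\<close> to form one \<open>2 * S\<close>; the
  losses are at most 5/8 + 1/8 + 1/64 of \<open>dens S * dens S\<close>.\<close>

lemma join_half_scale_low:
  assumes S: "S = 2 ^ k" "4 \<le> S" and c: "S \<le> c" "c < 2 * S" and e: "S < e" "e < 2 * S"
    and n: "c + e = S + n" "n < 2 * S"
    and IH: "superadditive_below (2 * S + c + (S + e))"
  shows "nopt (2 * S + c) + nopt (S + e) + dens (2 * S + c) * dens (S + e)
    \<le> nopt (2 * S + c + (S + e))"
proof -
  have "2 * S + c + (S + e) = 2 * S + (2 * S + n)" using n by simp
  moreover have "nopt (2 * S + (2 * S + n)) =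
      nopt (2 * S) + nopt (2 * S + n) + dens (2 * S) * dens (2 * S + n)"
    "nopt (2 * S + n) = nopt (2 * S) + nopt n + dens (2 * S) * dens n"
    "nopt (2 * S + c) = nopt (2 * S) + nopt c + dens (2 * S) * dens c"
    using assms by (intro nopt_split[of _ "Suc k"]; auto)+
  moreover have "nopt (S + S) = nopt S + nopt S + dens S * dens S"
    "nopt (S + e) = nopt S + nopt e + dens S * dens e"
    "nopt (S + n) = nopt S + nopt n + dens S * dens n"
    using assms by (intro nopt_split[of _ k]; auto)+
  moreover have "S + S = 2 * S" by simp
  moreover have "nopt c + nopt e + dens c * dens e \<le> nopt (S + n)"
    unfolding n(1)[symmetric] using assms by (intro superadditive_belowD[OF IH]) auto
  moreover have "dens S * dens n \<le> dens c * dens e"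
    using assms by (intro dens_mult_mono mult_le_mult_of_le_sum) auto
  moreover have "dens S * dens e \<le> dens S * (5 / 8 * dens S)"
    using assms by (intro mult_left_mono dens_less dens_nonneg) auto
  moreover have "dens (2 * S) * dens c \<le> (dens S / 8) * dens S"
    using assms by (intro mult_mono dens_much_less dens_antimono) (auto simp: dens_nonneg)
  moreover have "dens (2 * S + c) * dens (S + e) \<le> (dens S / 8) * (dens S / 8)"
    using assms by (intro mult_mono dens_much_less) (auto simp: dens_nonneg)
  moreover have "0 \<le> dens S * dens S" "0 \<le> dens (2 * S) * dens n"
      "0 \<le> dens (2 * S) * dens (2 * S + n)"
    by (simp_all add: dens_nonneg)
  ultimately show ?thesis by (simp del: zero_le_square)
qed

section \<open>Rotation and the case analysis\<close>

text \<open>The hypothesis on smaller totals merges \<open>q\<close> and \<open>r\<close>, the last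
  assumption covers the rotated split, and by \<open>dens_rotate\<close> its surplus is no
  smaller.\<close>

lemma nopt_rotate:
  assumes "superadditive_below (p + q + r)" "1 \<le> r" "r \<le> p" "1 \<le> q"
    and "nopt (p + q) = nopt p + nopt q + dens p * dens q"
    and "nopt p + nopt (q + r) + dens p * dens (q + r) \<le> nopt (p + (q + r))"
  shows "nopt (p + q) + nopt r + dens (p + q) * dens r \<le> nopt (p + q + r)"
proof -
  have "nopt q + nopt r + dens q * dens r \<le> nopt (q + r)"
    using assms by (intro superadditive_belowD[OF assms(1)]) auto
  with assms dens_rotate[of r p q] show ?thesis by (simp add: add.assoc)
qed

text \<open>\<open>IH\<close> covers splits of the same total with both parts below
  \<open>a\<close>. Rotation reaches one of these unless \<open>b\<close> is at least as large as
  both pieces of \<open>a\<close>; those splits are regrouped or already optimal.\<close>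

lemma nopt_superadditive_step:
  assumes "superadditive_below (a + b)" "1 \<le> b" "b \<le> a" "23 \<le> a + b"
    and IH: "\<And>x y. 1 \<le> x \<Longrightarrow> 1 \<le> y \<Longrightarrow> x + y = a + b \<Longrightarrow> x < a \<Longrightarrow> y < a \<Longrightarrow>
      nopt x + nopt y + dens x * dens y \<le> nopt (x + y)"
  shows "nopt a + nopt b + dens a * dens b \<le> nopt (a + b)"
proof -
  have "12 \<le> a" using assms by simp
  obtain P where P: "\<exists>k. P = 2 ^ k" "3 * P \<le> 2 * a" "a < 3 * P"
    using split_size_bounds[of a] \<open>12 \<le> a\<close> by auto
  then obtain k where k: "P = 2 ^ k" by blast
  \<comment> \<open>From \<open>12 <= a < 3 * P\<close> follows \<open>P > 4\<close>, hence
    \<open>P >= 8\<close> and \<open>S >= 4\<close>, as the estimates for \<open>dens\<close>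
    require.\<close>
  have "(2::nat) ^ 2 < 2 ^ k" using P k \<open>12 \<le> a\<close> by simp
  then have "2 < k" by (simp only: power_strict_increasing_iff) 
  then obtain i where i: "k = Suc i" "2 \<le> i" by (cases k) auto
  define S where "S = (2::nat) ^ i"
  have "(2::nat) ^ 2 \<le> 2 ^ i" using i by (intro power_increasing) simp_all
  then have S: "P = 2 * S" "4 \<le> S" using k i by (simp_all add: S_def)
  have "P \<le> a" using P by simp
  then obtain a' where a': "a = P + a'" using le_Suc_ex by blast
  have a'_bounds: "P \<le> 2 * a'" "a' < 2 * P" using P a' by simp_all
  have split: "nopt (P + a') = nopt P + nopt a' + dens P * dens a'"
    using a'_bounds S by (intro nopt_split[OF k]) auto
  \<comment> \<open>In the first two cases \<open>b\<close> is smaller than one piece of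
    \<open>a\<close> and is moved to the other piece. In the third \<open>b\<close> also splits off
    \<open>P\<close>, in the fifth only \<open>S\<close>; the fourth is already an optimal
    split.\<close>
  consider "b < P" | "P \<le> b" "b < a'" | "P \<le> b" "a' \<le> b" "3 * P \<le> 2 * b"
    | "b = P" "a' \<le> P" | "P < b" "a' \<le> b" "2 * b < 3 * P" by linarith
  then show ?thesis
  proof cases
    case 1
    have "nopt P + nopt (a' + b) + dens P * dens (a' + b) \<le> nopt (P + (a' + b))"
      using 1 a' a'_bounds assms S by (intro IH) auto
    with 1 show ?thesis
      using assms(1-4) a'_bounds split S unfolding a' by (intro nopt_rotate) auto
  next
    case 2
    have "nopt a' + nopt (P + b) + dens a' * dens (P + b) \<le> nopt (a' + (P + b))"
      using 2 a' a'_bounds assms S by (intro IH) auto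
    with 2 have "nopt (a' + P) + nopt b + dens (a' + P) * dens b \<le> nopt (a' + P + b)"
      using assms(1-4) a'_bounds split S unfolding a' by (intro nopt_rotate) (auto simp: ac_simps)
    then show ?thesis by (simp add: a' ac_simps)
  next
    case 3
    obtain b' where b': "b = P + b'" using le_Suc_ex[OF 3(1)] by blast
    have b'_bounds: "P \<le> 2 * b'" "b' < 2 * P" "b' \<le> a'" using 3 P assms a' b' by simp_all
    \<comment> \<open>If \<open>b' < P < a'\<close>, it matters whether \<open>a'\<close> splits off
      \<open>P\<close> or \<open>S\<close>.\<close>
    consider "a' \<le> P \<and> b' \<le> P \<or> P \<le> a' \<and> P \<le> b'" | "b' < P" "3 * P \<le> 2 * a'"
      | "P < a'" "2 * a' < 3 * P" "b' < P" using b'_bounds by linarith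
    then show ?thesis
    proof cases
      case 1
      with assms(1) k S a'_bounds b'_bounds show ?thesis
        unfolding a' b' by (intro join_same_scale) auto
    next
      case 2
      then have "P \<le> a'" by simp
      then obtain c where c: "a' = P + c" using le_Suc_ex by blast
      with 2 assms(1) k S a'_bounds b'_bounds show ?thesis
        unfolding a' b' c by (intro join_same_scale_large_small) auto
    next
      case 3
      then have "S \<le> a'" using S by simp
      then obtain c where c: "a' = S + c" using le_Suc_ex by blast
      have below': "superadditive_below (2 * S + (S + c) + (2 * S + b'))"
        using assms(1) unfolding a' b' c S(1) .
      have cb: "S < c" "c < 2 * S" "S \<le> b'" "b' < 2 * S" using 3 c S b'_bounds by simp_all
      show ?thesis
      proof (cases "c + b' < 3 * S")
        case True
        have "c + b' = S + (c + b' - S)" "c + b' - S < 2 * S" using True cb by simp_all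
        from join_same_scale_medium_small_low[OF S_def S(2) cb this below'] show ?thesis unfolding a' b' c S(1) .
      next
        case False
        have "c + b' = 2 * S + (c + b' - 2 * S)" "S \<le> c + b' - 2 * S" using False cb by simp_all
        from join_same_scale_medium_small_high[OF S_def S(2) cb this below'] show ?thesis unfolding a' b' c S(1) .
      qed
    qed
  next
    case 4
    show ?thesis
    proof (cases "a' < P")
      case True
      have "nopt (P + (P + a')) = nopt P + nopt (P + a') + dens P * dens (P + a')"
        using True S by (intro nopt_split[OF k]) auto
      with 4 show ?thesis by (simp add: a' ac_simps)
    next
      case False
      with 4 have "a' = P" by simp
      have "nopt ((P + P) + P) = nopt (P + P) + nopt P + dens (P + P) * dens P"
        using S k by (intro nopt_split[of _ "Suc k"]) auto
      with 4 \<open>a' = P\<close> show ?thesis by (simp add: a')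
    qed
  next
    case 5
    then have "S \<le> b" using S by simp
    then obtain e where e: "b = S + e" using le_Suc_ex by blast
    have eb: "S < e" "e < 2 * S" using 5 e S by simp_all
    consider "2 * S < a'" | "a' = 2 * S" | "a' < 2 * S" by linarith
    then show ?thesis
    proof cases
      case 1
      then have "S \<le> a'" by simp
      then obtain c where c: "a' = S + c" using le_Suc_ex by blast
      have cb: "S < c" "c < 2 * S" using 1 c S 5 by simp_all
      have "superadditive_below (2 * S + (S + c) + (S + e))"
        using assms(1) unfolding a' e c S(1) .
      from join_half_scale_large[OF S_def S(2) cb eb this] show ?thesis unfolding a' e c S(1) .
    next
      case 2
      have "nopt ((P + P) + b) = nopt (P + P) + nopt b + dens (P + P) * dens b"
        using S k 5 by (intro nopt_split[of _ "Suc k"]) auto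
      then show ?thesis using 2 S by (simp add: a')
    next
      case 3
      have cb: "S \<le> a'" "a' < 2 * S" using 3 S a'_bounds by simp_all
      have below': "superadditive_below (2 * S + a' + (S + e))"
        using assms(1) unfolding a' e S(1) .
      show ?thesis
      proof (cases "a' + e < 3 * S")
        case True
        have "a' + e = S + (a' + e - S)" "a' + e - S < 2 * S" using True cb eb by simp_all
        from join_half_scale_low[OF S_def S(2) cb eb this below'] show ?thesis unfolding a' e S(1) .
      next
        case False
        have "a' + e = 2 * S + (a' + e - 2 * S)" "S \<le> a' + e - 2 * S" using False cb by simp_all
        from join_half_scale_high[OF S_def S(2) cb eb this below'] show ?thesis unfolding a' e S(1) .
      qed
    qed
  qed
qed

text \<open>The outer induction is on the total, the inner one on the larger part at fixed total,
  since rotation keeps the total and lowers the larger part.\<close>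

lemma nopt_superadditive:
  assumes "1 \<le> a" "1 \<le> b"
  shows "nopt a + nopt b + dens a * dens b \<le> nopt (a + b)"
  using assms
proof (induction "a + b" arbitrary: a b rule: less_induct)
  case (less a b)
  define m where "m = a + b"
  have below: "superadditive_below m"
    using less.hyps by (auto simp: superadditive_below_def m_def)
  have ordered: "nopt x + nopt y + dens x * dens y \<le> nopt (x + y)"
    if "1 \<le> y" "y \<le> x" "x + y = m" for x y
    using that
  proof (induction x arbitrary: y rule: less_induct)
    case (less x y)
    show ?case
    proof (cases "m \<le> 22")
      case True
      with less.prems show ?thesis
        unfolding nopt_join_le_iff by (intro opt_superadditive_small) auto
    next
      case False
      show ?thesis
      proof (rule nopt_superadditive_step)
        fix x' y' assume "1 \<le> x'" "1 \<le> y'" "x' + y' = x + y" "x' < x" "y' < x"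
        then show "nopt x' + nopt y' + dens x' * dens y' \<le> nopt (x' + y')"
          using less.IH[of x' y'] less.IH[of y' x'] less.prems(3)
          by (cases "y' \<le> x'") (auto simp: ac_simps)
      qed (use False below less.prems in auto)
    qed
  qed
  show ?case
    using ordered[of b a] ordered[of a b] less.prems by (cases "b \<le> a") (auto simp: m_def ac_simps)
qed

lemma opt_superadditive:
  assumes "1 \<le> a" "1 \<le> b"
  shows "opt a * 2 ^ b + opt b * 2 ^ a + a * b \<le> opt (a + b)"
  using nopt_superadditive[OF assms] by (simp only: nopt_join_le_iff)

section \<open>The maximal weight\<close>

lemma weight_small:
  assumes "card V \<in> {1, 2}"
  shows "weight V {#} = opt (card V)"
proof -
  have fin: "finite V" using assms by (auto intro: card_ge_0_finite)
  consider "card V = 1" | "card V = 2" using assms by auto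
  then show ?thesis
  proof cases
    case 1
    then have "e \<notin> pairs V" for e using card_mono[OF fin, of e] by (auto simp: pairs_def)
    then have "pairs V = {}" by blast
    then show ?thesis by (simp only: weight_def 1 opt_table) simp
  next
    case 2
    then have "pairs V = {V}" using card_subset_eq[OF fin] by (auto simp: pairs_def)
    then show ?thesis by (simp only: weight_def 2 opt_table) simp
  qed
qed

lemma weight_le_opt: "two_recursive V G \<Longrightarrow> weight V G \<le> opt (card V)"
proof (induction rule: two_recursive.induct)
  case (small V)
  then show ?case by (simp only: weight_small)
next
  case (split V G V1 V2 G1 G2)
  have tcm: "tcm V1 G1" "tcm V2 G2" using split by (auto intro: two_recursive_imp_tcm)
  then have fin: "finite V1" "finite V2" by (auto simp: tcm_def)
  have "weight V G \<le> opt (card V1) * 2 ^ card V2 + opt (card V2) * 2 ^ card V1 + card V1 * card V2"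
    unfolding \<open>G = _\<close> \<open>V = _\<close> weight_split[OF tcm \<open>V1 \<inter> V2 = {}\<close>]
    using split.IH by (intro add_mono mult_le_mono1) auto
  also have "\<dots> \<le> opt (card V1 + card V2)"
    using fin split by (intro opt_superadditive) (auto simp: Suc_le_eq card_gt_0_iff)
  finally show ?case using fin split by (simp add: card_Un_disjoint)
qed

text \<open>Supplies the part sizes from which an extremal multigraph is built: 3 and 3 at 6, the
  power of two and the rest elsewhere.\<close>

lemma opt_attained:
  assumes "2 \<le> n"
  shows "\<exists>a b. 1 \<le> a \<and> 1 \<le> b \<and> n = a + b \<and> opt n = opt a * 2 ^ b + opt b * 2 ^ a + a * b"
proof (cases "n = 6")
  case True
  then show ?thesis by (intro exI[of _ 3]) (simp add: opt_table)
next
  case False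
  then show ?thesis using split_size_bounds(2,3)[OF assms] assms
    by (intro exI[of _ "split_size n"] exI[of _ "n - split_size n"]) (auto simp: opt.simps[of n])
qed

lemma two_recursive_weight_opt:
  assumes "finite V" "1 \<le> card V"
  shows "\<exists>G. two_recursive V G \<and> weight V G = opt (card V)"
  using assms
proof (induction "card V" arbitrary: V rule: less_induct)
  case less
  show ?case
  proof (cases "3 \<le> card V")
    case False
    with less.prems have c: "card V \<in> {1, 2}" by auto
    have "T \<notin> triples V" for T
      using card_mono[OF less.prems(1), of T] False by (auto simp: triples_def)
    then have "triples V = {}" by blast
    then have "tcm V {#}" using less.prems by (simp add: tcm_def)
    with c show ?thesis using two_recursive.small weight_small by blast
  next
    case True
    then obtain a b where ab: "1 \<le> a" "1 \<le> b" "card V = a + b"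
        "opt (card V) = opt a * 2 ^ b + opt b * 2 ^ a + a * b"
      using opt_attained[of "card V"] by auto
    obtain V1 where V1: "V1 \<subseteq> V" "card V1 = a"
      using obtain_subset_with_card_n[of a V] ab by auto
    define V2 where "V2 = V - V1"
    have fin: "finite V1" "finite V2" using V1 less.prems by (auto simp: V2_def intro: finite_subset)
    have V2: "card V2 = b" using V1 fin ab by (simp add: V2_def card_Diff_subset)
    have V: "V = V1 \<union> V2" "V1 \<inter> V2 = {}" using V1 by (auto simp: V2_def)
    have ne: "V1 \<noteq> {}" "V2 \<noteq> {}" using V1 V2 ab by auto
    obtain G1 where G1: "two_recursive V1 G1" "weight V1 G1 = opt a"
      using less.hyps[of V1] V1 fin ab by auto
    obtain G2 where G2: "two_recursive V2 G2" "weight V2 G2 = opt b"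
      using less.hyps[of V2] V2 fin ab by auto
    note tcm = two_recursive_imp_tcm[OF G1(1)] two_recursive_imp_tcm[OF G2(1)]
    have "two_recursive V (G1 + G2 + crossing V1 V2)"
      using tcm_union[OF tcm V(2)] True V ne G1 G2
      by (intro two_recursive.split[of V _ V1 V2 G1 G2]) auto
    moreover have "weight V (G1 + G2 + crossing V1 V2) = opt (card V)"
      using weight_split[OF tcm V(2)] V(1) G1 G2 V1 V2 ab by simp
    ultimately show ?thesis by blast
  qed
qed

text \<open>No two-recursive multigraph has an empty vertex set, so at \<open>m = 0\<close> the
  maximum would be over the empty set.\<close>

lemma H2_eq_opt:
  assumes "1 \<le> m"
  shows "H2 m = opt m"
  unfolding H2_def
proof (rule Max_eqI)
  show "finite {weight2 m G | G. two_recursive {1..m} G}" by (rule H2_max_wf)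
  have w: "weight2 m G = weight {1..m} G" for G by (simp add: weight2_def weight_def)
  show "y \<le> opt m" if "y \<in> {weight2 m G | G. two_recursive {1..m} G}" for y
    using that weight_le_opt[of "{1..m}"] by (auto simp: w)
  show "opt m \<in> {weight2 m G | G. two_recursive {1..m} G}"
  proof -
    obtain G where "two_recursive {1..m} G" "weight {1..m} G = opt m"
      using two_recursive_weight_opt[of "{1..m}"] assms by auto
    then have "opt m = weight2 m G \<and> two_recursive {1..m} G" by (simp add: w)
    then show ?thesis by blast
  qed
qed

section \<open>The limit\<close>

text \<open>With \<open>q = n div m\<close>, superadditivity gives \<open>q * f m <= f n\<close>,
  and \<open>q\<close> is at least \<open>(n - m) / m\<close>.\<close>

lemma superadditive_div_le:
  fixes f :: "nat \<Rightarrow> real"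
  assumes super: "\<And>a b. f a + f b \<le> f (a + b)" and nonneg: "\<And>n. 0 \<le> f n"
    and "1 \<le> m" "1 \<le> n"
  shows "f m / m * (1 - m / n) \<le> f n / n"
proof -
  have "real q * f m \<le> f (q * m + r)" for q r
  proof (induction q)
    case (Suc q)
    then show ?case using super[of m "q * m + r"] by (simp add: algebra_simps)
  qed (simp add: nonneg)
  from this[of "n div m" "n mod m"] have le: "real (n div m) * f m \<le> f n" by simp
  have "n \<le> m * (n div m) + m" using assms(3) mult_div_mod_eq[of m n] mod_less_divisor[of m n] by linarith
  then have "real n \<le> real m * real (n div m) + real m"
    by (simp only: of_nat_mult[symmetric] of_nat_add[symmetric] of_nat_le_iff)
  then have "(real n - real m) / real m \<le> real (n div m)" using assms(3) by (simp add: field_simps)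
  from mult_right_mono[OF this nonneg[of m]] le have "(real n - real m) / real m * f m / n \<le> f n / n"
    by (intro divide_right_mono) simp_all
  moreover have "f m / m * (1 - m / n) = (real n - real m) / real m * f m / n"
    using assms(3,4) by (simp add: field_simps)
  ultimately show ?thesis by (simp only:)
qed

text \<open>Fekete's argument with a limit along \<open>N\<close> in place of the supremum. Letting
  \<open>n\<close> run through \<open>N\<close> in \<open>superadditive_div_le\<close> gives
  \<open>f m / m <= L\<close>; one \<open>N k\<close> with ratio above \<open>y\<close> forces
  ratios above \<open>y\<close> for all large \<open>n\<close>.\<close>

lemma superadditive_limit:
  fixes f :: "nat \<Rightarrow> real" and N :: "nat \<Rightarrow> nat"
  assumes super: "\<And>a b. f a + f b \<le> f (a + b)" and nonneg: "\<And>n. 0 \<le> f n"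
    and N: "filterlim N at_top sequentially" and L: "(\<lambda>k. f (N k) / N k) \<longlonglongrightarrow> L"
  shows "(\<lambda>n. f n / n) \<longlonglongrightarrow> L"
proof (rule order_tendstoI)
  have lim: "(\<lambda>n. f m / m * (1 - m / real n)) \<longlonglongrightarrow> f m / m" for m
  proof -
    have "(\<lambda>n. f m / m * (1 - m / real n)) \<longlonglongrightarrow> f m / m * (1 - 0)"
      by (intro tendsto_intros lim_const_over_n)
    then show ?thesis by simp
  qed
  have N1: "\<forall>\<^sub>F k in sequentially. 1 \<le> N k" using N by (simp add: filterlim_at_top)
  have le: "f m / m \<le> L" if "1 \<le> m" for m
  proof (rule tendsto_le[OF trivial_limit_sequentially L])
    show "(\<lambda>k. f m / m * (1 - m / real (N k))) \<longlonglongrightarrow> f m / m"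
      by (rule filterlim_compose[OF lim N])
    show "\<forall>\<^sub>F k in sequentially. f m / m * (1 - m / real (N k)) \<le> f (N k) / N k"
      using N1 by eventually_elim (use superadditive_div_le[of f] super nonneg that in blast)
  qed
  show "\<forall>\<^sub>F n in sequentially. f n / n < y" if "L < y" for y
    using eventually_ge_at_top[of 1] by eventually_elim (use le that in force)
  show "\<forall>\<^sub>F n in sequentially. y < f n / n" if y: "y < L" for y
  proof -
    have "\<forall>\<^sub>F k in sequentially. y < f (N k) / N k \<and> 1 \<le> N k"
      using order_tendstoD(1)[OF L y] N1 by eventually_elim simp
    then obtain k where k: "y < f (N k) / N k" "1 \<le> N k"
      by (auto dest: eventually_happens)
    show ?thesis
      using order_tendstoD(1)[OF lim[of "N k"] k(1)] eventually_ge_at_top[of 1]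
    proof eventually_elim
      case (elim n)
      with superadditive_div_le[of f "N k" n] super nonneg k(2) show ?case by fastforce
    qed
  qed
qed

section \<open>Evaluation along powers of two\<close>

text \<open>Doubling \<open>2 ^ k\<close> raises the ratio by
  \<open>dens (2 ^ k) * dens (2 ^ k) / 2 ^ Suc k\<close>, half the next term of the series. The
  series starts at index 1, hence \<open>Suc j\<close>.\<close>

lemma nopt_power_two:
  "nopt (2 ^ k) / 2 ^ k = (\<Sum>j<k. 2 ^ (Suc j - 1) / 2 ^ (2 ^ Suc j)) / 2"
proof (induction k)
  case 0
  have "opt (Suc 0) = 0" by (simp add: opt.simps)
  then show ?case by (simp add: nopt_def)
next
  case (Suc k)
  \<comment> \<open>Keeps the doubled total away from 6, the exception in
    \<open>nopt_split\<close>.\<close>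
  have "(2::nat) ^ k \<noteq> 3"
  proof
    assume "(2::nat) ^ k = 3"
    then obtain i where "k = Suc i" by (cases k) simp_all
    with \<open>2 ^ k = 3\<close> have "2 * 2 ^ i = (3::nat)" by simp
    then show False by presburger
  qed
  then have double: "nopt (2 ^ k + 2 ^ k) = nopt (2 ^ k) + nopt (2 ^ k) + dens (2 ^ k) * dens (2 ^ k)"
    by (intro nopt_split[of _ k]) auto
  have "nopt (2 ^ Suc k) = 2 * nopt (2 ^ k) + dens (2 ^ k) * dens (2 ^ k)"
  proof -
    have "(2::nat) ^ k + 2 ^ k = 2 ^ Suc k" by simp
    then show ?thesis using double by (simp only: mult_2)
  qed
  then have "nopt (2 ^ Suc k) / 2 ^ Suc k = nopt (2 ^ k) / 2 ^ k + dens (2 ^ k) * dens (2 ^ k) / 2 ^ Suc k"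
    by (simp add: add_divide_distrib)
  also have "dens (2 ^ k) * dens (2 ^ k) / 2 ^ Suc k = (2 ^ (Suc k - 1) / 2 ^ (2 ^ Suc k)) / 2"
  proof -
    have "(2::real) ^ (2 ^ k) * 2 ^ (2 ^ k) = 2 ^ (2 ^ Suc k)" by (simp flip: power_add mult_2)
    then have "dens (2 ^ k) * dens (2 ^ k) = 2 ^ k * 2 ^ k / 2 ^ (2 ^ Suc k)" by (simp add: dens_def)
    then show ?thesis by simp
  qed
  finally show ?case by (simp add: Suc.IH add_divide_distrib)
qed

lemma summable_series: "summable (\<lambda>j. 2 ^ (Suc j - 1) / 2 ^ (2 ^ Suc j) :: real)"
proof (rule summable_comparison_test)
  have "(2 ^ j / 2 ^ (2 ^ Suc j) :: real) \<le> (1 / 2) ^ j" for j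
  proof -
    have "2 * j \<le> 2 ^ Suc j" using less_exp[of j] by simp
    then have "(2::real) ^ (2 * j) \<le> 2 ^ (2 ^ Suc j)" by (intro power_increasing) simp_all
    then have "(2::real) ^ j / 2 ^ (2 ^ Suc j) \<le> 2 ^ j / 2 ^ (2 * j)"
      by (intro divide_left_mono) simp_all
    also have "\<dots> = (1 / 2) ^ j" by (simp add: mult_2 power_add power_one_over)
    finally show ?thesis .
  qed
  then show "\<exists>N. \<forall>n\<ge>N. norm (2 ^ (Suc n - 1) / 2 ^ (2 ^ Suc n) :: real) \<le> (1 / 2) ^ n"
    by simp
qed (simp add: summable_geometric)

lemma opt_limit:
  "(\<lambda>m. real (opt m) / (real m * 2 ^ (m - 1))) \<longlonglongrightarrow> (\<Sum>j. 2 ^ (Suc j - 1) / 2 ^ (2 ^ Suc j))"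
    (is "_ \<longlonglongrightarrow> ?L")
proof -
  have "(\<lambda>n. nopt n / n) \<longlonglongrightarrow> ?L / 2"
  proof (rule superadditive_limit)
    show "nopt a + nopt b \<le> nopt (a + b)" for a b
    proof (cases "a = 0 \<or> b = 0")
      case True
      then show ?thesis by (auto simp: nopt_def opt.simps[of 0])
    next
      case False
      then have "nopt a + nopt b + dens a * dens b \<le> nopt (a + b)"
        by (intro nopt_superadditive) simp_all
      moreover have "0 \<le> dens a * dens b" by (simp add: dens_nonneg)
      ultimately show ?thesis by linarith
    qed
    show "0 \<le> nopt n" for n by (simp add: nopt_def)
    show "filterlim (\<lambda>k. 2 ^ k :: nat) at_top sequentially"
      by (rule filterlim_subseq) (simp add: strict_mono_def)
    have "(\<lambda>k. (\<Sum>j<k. 2 ^ (Suc j - 1) / 2 ^ (2 ^ Suc j)) / 2) \<longlonglongrightarrow> ?L / 2"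
      by (intro tendsto_divide summable_LIMSEQ summable_series tendsto_const) simp
    then show "(\<lambda>k. nopt (2 ^ k) / real (2 ^ k)) \<longlonglongrightarrow> ?L / 2"
      by (simp only: nopt_power_two[symmetric] of_nat_power of_nat_numeral)
  qed
  then have "(\<lambda>n. 2 * (nopt n / n)) \<longlonglongrightarrow> 2 * (?L / 2)" by (rule tendsto_mult_left)
  \<comment> \<open>The factor 2 turns \<open>2 ^ n\<close> into \<open>2 ^ (n - 1)\<close>; at
    \<open>n = 0\<close> both sides are 0 because division by zero yields 0.\<close>
  moreover have "2 * (nopt n / n) = real (opt n) / (real n * 2 ^ (n - 1))" for n
    by (cases n) (simp_all add: nopt_def)
  ultimately show ?thesis by simp
qed

text \<open>The bounds are 3/2 and 3 times \<open>2 powi j\<close>, so the half-open intervals of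
  distinct integers \<open>j\<close> are disjoint. With \<open>powi\<close>, uniqueness also covers
  negative exponents.\<close>

lemma powi_interval_iff:
  fixes m k :: nat and j :: int
  assumes k: "3 * 2 ^ k \<le> 2 * m" "m < 3 * 2 ^ k"
  shows "(2::real) powi j + 2 powi (j - 1) \<le> real m \<and> real m < 2 powi j + 2 powi (j + 1)
    \<longleftrightarrow> j = int k"
proof -
  have shift: "(2::real) powi (i - 1) = 2 powi i / 2" "(2::real) powi (i + 1) = 2 * 2 powi i" for i
    by (simp_all add: power_int_diff power_int_add)
  have "real (3 * 2 ^ k) \<le> real (2 * m)" "real m < real (3 * 2 ^ k)"
    using k by (simp_all only: of_nat_le_iff of_nat_less_iff)
  then have k': "3 * (2::real) powi int k \<le> 2 * real m" "real m < 3 * 2 powi int k"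
    by simp_all
  have "(2::real) * 2 powi i \<le> 2 powi i'" if "i < i'" for i i'
    using power_int_increasing[of "i + 1" i' "2::real"] that by (simp add: shift)
  from this[of j "int k"] this[of "int k" j] k' show ?thesis
    unfolding shift by (cases j "int k" rule: linorder_cases) auto
qed

theorem theorem1p9:
  "(\<forall>m::nat. m \<ge> 3 \<and> m \<noteq> 6 \<longrightarrow>
      (\<exists>k::nat.
         (\<forall>j::int. (2::real) powi j + 2 powi (j - 1) \<le> real m \<and>
                   real m < 2 powi j + 2 powi (j + 1) \<longleftrightarrow> j = int k) \<and>
         H2 m = H2 (2 ^ k) * 2 ^ (m - 2 ^ k) + H2 (m - 2 ^ k) * 2 ^ (2 ^ k) + 2 ^ k * (m - 2 ^ k)))
   \<and> H2 6 = 2 * H2 3 * 2 ^ 3 + 9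
   \<and> (\<lambda>m. real (H2 m) / (real m * 2 ^ (m - 1)))
        \<longlonglongrightarrow> (\<Sum>j. 2 ^ (Suc j - 1) / 2 ^ (2 ^ Suc j))"
proof (intro conjI allI impI)
  fix m :: nat assume m: "m \<ge> 3 \<and> m \<noteq> 6"
  obtain k where "split_size m = 2 ^ k" using split_size_bounds(1)[of m] m by auto
  with m have k: "3 * 2 ^ k \<le> 2 * m" "m < 3 * 2 ^ k"
    using split_size_bounds(2,3)[of m] by simp_all
  \<comment> \<open>\<open>H2_eq_opt\<close> needs this for the remainder
    \<open>m - 2 ^ k\<close>.\<close>
  then have "1 \<le> m - 2 ^ k" using m by (cases k) auto
  then have "H2 m = H2 (2 ^ k) * 2 ^ (m - 2 ^ k) + H2 (m - 2 ^ k) * 2 ^ (2 ^ k) + 2 ^ k * (m - 2 ^ k)"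
    using m opt_split[OF k] by (simp add: H2_eq_opt)
  with powi_interval_iff[OF k] show "\<exists>k::nat.
         (\<forall>j::int. (2::real) powi j + 2 powi (j - 1) \<le> real m \<and>
                   real m < 2 powi j + 2 powi (j + 1) \<longleftrightarrow> j = int k) \<and>
         H2 m = H2 (2 ^ k) * 2 ^ (m - 2 ^ k) + H2 (m - 2 ^ k) * 2 ^ (2 ^ k) + 2 ^ k * (m - 2 ^ k)"
    by blast
next
  show "H2 6 = 2 * H2 3 * 2 ^ 3 + 9" by (simp add: H2_eq_opt opt_table)
next
  \<comment> \<open>The two sequences are identified only from 1 on, as \<open>H2_eq_opt\<close>
    says nothing about \<open>H2 0\<close>.\<close>
  have "\<forall>\<^sub>F m in sequentially. real (opt m) / (real m * 2 ^ (m - 1)) = real (H2 m) / (real m * 2 ^ (m - 1))"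
    using eventually_ge_at_top[of 1] by eventually_elim (simp add: H2_eq_opt)
  from Lim_transform_eventually[OF opt_limit this]
  show "(\<lambda>m. real (H2 m) / (real m * 2 ^ (m - 1)))
        \<longlonglongrightarrow> (\<Sum>j. 2 ^ (Suc j - 1) / 2 ^ (2 ^ Suc j))" .
qed

end
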